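(* Let $G$ be a finite structure over the signature $\{L,R,U,D,B_V,B_H\}$ ($L,R,U,D$ binary, $B_V,B_H$ unary) which satisfies the sentence $\phi_1$ described in the context, and whose Gaifman graph with respect to $L,R,U,D$ is connected. Suppose there exist an element $v$ of $G$ and a relation $X \in \{L,R,U,D\}$ such that there is no $w$ with $X(v,w)$. Then $G$, restricted to the relations $L,R,U,D$, is isomorphic to a rectangular grid.
   Context: A rectangular grid is a structure $(V,L,R,U,D)$ with $V=\{0,\ldots,x^*\}\times\{0,\ldots,y^*\}$ for some integers $x^*,y^*\ge 0$, where the binary relations hold exactly in the following cases (whenever both vertices exist): $L((x,y),(x-1,y))$, $R((x,y),(x+1,y))$, $U((x,y),(x,y-1))$, $D((x,y),(x,y+1))$. The sentence $\phi_1$ is the conjunction of the following axioms. (Partial functionality) For each $X\in\{L,R,U,D\}$: $\forall x\forall y\forall z\,(X(x,y)\wedge X(x,z)\Rightarrow y=z)$; when it exists, the unique $y$ with $X(x,y)$ is written $X(x)$. (Inverses) $\forall x\forall y\,(R(x,y)\iff L(y,x))$ and $\forall x\forall y\,(U(x,y)\iff D(y,x))$. (Commutativity) For each $H\in\{L,R\}$ and $V\in\{U,D\}$: $\forall x\forall y\forall z\,(H(x,y)\wedge V(x,z)\Rightarrow \exists t\,(H(z,t)\wedge V(y,t)))$. (Horizontal zero) $\forall x\,((\neg\exists y\,U(x,y))\Rightarrow \neg B_V(x))$. (Horizontal increment) $\forall x\,((\exists y\,U(x,y))\Rightarrow ((B_V(x)\not\iff B_V(U(x)))\iff C(x)))$,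 where $C(x)$ is $(\neg\exists y\,L(x,y))\vee(\neg B_V(L(x))\wedge B_V(U(L(x))))$. (No horizontal overflow) $\forall x\,((\neg\exists y\,R(x,y))\Rightarrow\neg B_V(x))$. (Vertical counter, the analogous axioms for $B_H$, counting columns from right to left with least significant bit at the bottom) $\forall x\,((\neg\exists y\,R(x,y))\Rightarrow\neg B_H(x))$; $\forall x\,((\exists y\,R(x,y))\Rightarrow((B_H(x)\not\iff B_H(R(x)))\iff C'(x)))$ where $C'(x)$ is $(\neg\exists y\,D(x,y))\vee(\neg B_H(D(x))\wedge B_H(R(D(x))))$; $\forall x\,((\neg\exists y\,U(x,y))\Rightarrow\neg B_H(x))$. *)

theory Defs imports Main begin

datatype dir = L | R | U | D

record 'a lrud =
  universe :: "'a set"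
  rel :: "dir \<Rightarrow> 'a \<Rightarrow> 'a \<Rightarrow> bool"

text \<open>Structures over the full signature extend the \<open>L,R,U,D\<close>-structures, so that
  \<open>lrud.truncate\<close> is the reduct forgetting \<open>BV\<close> and \<open>BH\<close>.\<close>

record 'a counter_structure = "'a lrud" +
  BV :: "'a \<Rightarrow> bool"
  BH :: "'a \<Rightarrow> bool"

definition is_structure :: "'a counter_structure \<Rightarrow> bool" where
  "is_structure G \<longleftrightarrow>
     (\<forall>X x y. rel G X x y \<longrightarrow> x \<in> universe G \<and> y \<in> universe G) \<and>
     (\<forall>x. BV G x \<longrightarrow> x \<in> universe G) \<and>
     (\<forall>x. BH G x \<longrightarrow> x \<in> universe G)"

definition has :: "('a, 'm) lrud_scheme \<Rightarrow> dir \<Rightarrow> 'a \<Rightarrow> bool" where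
  "has G X x \<longleftrightarrow> (\<exists>y \<in> universe G. rel G X x y)"

text \<open>The partial function \<open>X(x)\<close>. In \<open>phi1\<close> it is only relevant where it is defined: every use
  is guarded by an existence condition, except that \<open>U(L(x))\<close> in \<open>carryV\<close> (and dually \<open>R(D(x))\<close>
  in \<open>carryH\<close>) exists by commutativity, as \<open>U(x)\<close> and \<open>L(x)\<close> do.\<close>

definition app :: "('a, 'm) lrud_scheme \<Rightarrow> dir \<Rightarrow> 'a \<Rightarrow> 'a" where
  "app G X x = (THE y. y \<in> universe G \<and> rel G X x y)"

definition partial_functionality :: "('a, 'm) lrud_scheme \<Rightarrow> bool" where
  "partial_functionality G \<longleftrightarrow>
     (\<forall>X. \<forall>x \<in> universe G. \<forall>y \<in> universe G. \<forall>z \<in> universe G.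
        rel G X x y \<and> rel G X x z \<longrightarrow> y = z)"

definition inverses :: "('a, 'm) lrud_scheme \<Rightarrow> bool" where
  "inverses G \<longleftrightarrow>
     (\<forall>x \<in> universe G. \<forall>y \<in> universe G. rel G R x y \<longleftrightarrow> rel G L y x) \<and>
     (\<forall>x \<in> universe G. \<forall>y \<in> universe G. rel G U x y \<longleftrightarrow> rel G D y x)"

definition commutativity :: "('a, 'm) lrud_scheme \<Rightarrow> bool" where
  "commutativity G \<longleftrightarrow>
     (\<forall>H \<in> {L, R}. \<forall>V \<in> {U, D}.
        \<forall>x \<in> universe G. \<forall>y \<in> universe G. \<forall>z \<in> universe G.
          rel G H x y \<and> rel G V x z \<longrightarrow>
          (\<exists>t \<in> universe G. rel G H z t \<and> rel G V y t))"

definition carryV :: "'a counter_structure \<Rightarrow> 'a \<Rightarrow> bool" where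
  "carryV G x \<longleftrightarrow>
     \<not> has G L x \<or> (\<not> BV G (app G L x) \<and> BV G (app G U (app G L x)))"

definition horizontal_counter :: "'a counter_structure \<Rightarrow> bool" where
  "horizontal_counter G \<longleftrightarrow>
     (\<forall>x \<in> universe G. \<not> has G U x \<longrightarrow> \<not> BV G x) \<and>
     (\<forall>x \<in> universe G. has G U x \<longrightarrow>
        ((BV G x \<noteq> BV G (app G U x)) \<longleftrightarrow> carryV G x)) \<and>
     (\<forall>x \<in> universe G. \<not> has G R x \<longrightarrow> \<not> BV G x)"

definition carryH :: "'a counter_structure \<Rightarrow> 'a \<Rightarrow> bool" where
  "carryH G x \<longleftrightarrow>
     \<not> has G D x \<or> (\<not> BH G (app G D x) \<and> BH G (app G R (app G D x)))"

definition vertical_counter :: "'a counter_structure \<Rightarrow> bool" where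
  "vertical_counter G \<longleftrightarrow>
     (\<forall>x \<in> universe G. \<not> has G R x \<longrightarrow> \<not> BH G x) \<and>
     (\<forall>x \<in> universe G. has G R x \<longrightarrow>
        ((BH G x \<noteq> BH G (app G R x)) \<longleftrightarrow> carryH G x)) \<and>
     (\<forall>x \<in> universe G. \<not> has G U x \<longrightarrow> \<not> BH G x)"

definition phi1 :: "'a counter_structure \<Rightarrow> bool" where
  "phi1 G \<longleftrightarrow>
     partial_functionality G \<and> inverses G \<and> commutativity G \<and>
     horizontal_counter G \<and> vertical_counter G"

definition gaifman_adj :: "('a, 'm) lrud_scheme \<Rightarrow> 'a \<Rightarrow> 'a \<Rightarrow> bool" where
  "gaifman_adj G x y \<longleftrightarrow>
     x \<in> universe G \<and> y \<in> universe G \<and> x \<noteq> y \<and> (\<exists>X. rel G X x y \<or> rel G X y x)"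

definition gaifman_connected :: "('a, 'm) lrud_scheme \<Rightarrow> bool" where
  "gaifman_connected G \<longleftrightarrow>
     (\<forall>x \<in> universe G. \<forall>y \<in> universe G. (gaifman_adj G)\<^sup>*\<^sup>* x y)"

text \<open>The second coordinate grows downwards.\<close>

fun step :: "dir \<Rightarrow> int \<times> int \<Rightarrow> int \<times> int" where
  "step L (x, y) = (x - 1, y)"
| "step R (x, y) = (x + 1, y)"
| "step U (x, y) = (x, y - 1)"
| "step D (x, y) = (x, y + 1)"

definition grid :: "int \<Rightarrow> int \<Rightarrow> (int \<times> int) lrud" where
  "grid xmax ymax =
     \<lparr>universe = {0..xmax} \<times> {0..ymax},
      rel = (\<lambda>X p q. p \<in> {0..xmax} \<times> {0..ymax} \<and> q \<in> {0..xmax} \<times> {0..ymax} \<and> q = step X p)\<rparr>"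

definition isomorphic :: "'a lrud \<Rightarrow> 'b lrud \<Rightarrow> bool" where
  "isomorphic A B \<longleftrightarrow>
     (\<exists>f. bij_betw f (universe A) (universe B) \<and>
        (\<forall>X. \<forall>x \<in> universe A. \<forall>y \<in> universe A. rel A X x y \<longleftrightarrow> rel B X (f x) (f y)))"

end

theory Submission imports Defs begin

text \<open>Commutativity makes the existence of a vertical neighbour constant along rows and the
  existence of a horizontal neighbour constant along columns. By finiteness, an orbit of one of the
  partial injections either closes up to a cycle or ends at both sides. If rows end but columns are
  cycles, the least significant bit of the counter \<open>BV\<close> flips at every step of its column;
  since the column is a cycle, it also flips from \<open>1\<close> to \<open>0\<close>, so the next bit flips somewhere on its
  column, and so on up to the last column, where overflow is forbidden. Hence rows and columns
  both end, there is a top left corner, and the translates of this corner form the grid.\<close>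

section \<open>Opposite and orthogonal directions; commuting partial injections\<close>

fun opp :: "dir \<Rightarrow> dir" where
  "opp L = R" | "opp R = L" | "opp U = D" | "opp D = U"

lemma opp_opp [simp]: "opp (opp X) = X"
  by (cases X) auto

definition orth :: "dir \<Rightarrow> dir \<Rightarrow> bool" where
  "orth X Y \<longleftrightarrow> Y \<noteq> X \<and> Y \<noteq> opp X"

lemma orth_opp [simp]: "orth (opp X) Y = orth X Y" "orth X (opp Y) = orth X Y"
  by (cases X; cases Y; simp add: orth_def)+

lemma orth_sym: "orth X Y \<Longrightarrow> orth Y X"
  by (cases X; cases Y; simp add: orth_def)

text \<open>Keeps only what is symmetric under reversing directions and exchanging rows with
  columns, so that each lemma serves all four directions. With \<open>rel_opp\<close>, uniqueness of
  successors also gives injectivity.\<close>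

locale commuting_structure =
  fixes G :: "('a, 'm) lrud_scheme"
  assumes finite_universe: "finite (universe G)"
    and rel_universe: "rel G X x y \<Longrightarrow> x \<in> universe G \<and> y \<in> universe G"
    and rel_unique: "rel G X x y \<Longrightarrow> rel G X x z \<Longrightarrow> y = z"
    and rel_opp: "rel G (opp X) y x \<longleftrightarrow> rel G X x y"
    and commute: "orth X Y \<Longrightarrow> rel G X x y \<Longrightarrow> rel G Y x z \<Longrightarrow> \<exists>t. rel G X z t \<and> rel G Y y t"
begin

lemma has_iff: "has G X x \<longleftrightarrow> (\<exists>y. rel G X x y)"
  using rel_universe by (auto simp: has_def)

lemma app_eq: "rel G X x y \<Longrightarrow> app G X x = y"
  unfolding app_def using rel_universe rel_unique by blast

lemma rel_app: "has G X x \<Longrightarrow> rel G X x (app G X x)"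
  using app_eq has_iff by metis

lemma rel_inj: "rel G X x z \<Longrightarrow> rel G X y z \<Longrightarrow> x = y"
  using rel_opp rel_unique by metis

text \<open>Commutativity transports a \<open>Y\<close>-neighbour from \<open>x\<close> to
  \<open>y\<close>; applied to the reversed step from \<open>y\<close> to \<open>x\<close>, it
  transports one back.\<close>

lemma has_orth: "orth X Y \<Longrightarrow> rel G X x y \<Longrightarrow> has G Y x \<longleftrightarrow> has G Y y"
  using commute[of X Y x y] commute[of "opp X" Y y x] unfolding has_iff rel_opp orth_opp by blast

section \<open>Walks along a set of directions\<close>

definition walk :: "dir set \<Rightarrow> 'a \<Rightarrow> 'a \<Rightarrow> bool" where
  "walk S = (\<lambda>x y. \<exists>X\<in>S. rel G X x y)\<^sup>*\<^sup>*"

lemma walk_refl [simp]: "walk S x x"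
  by (simp add: walk_def)

lemma walk_step: "walk S x y \<Longrightarrow> X \<in> S \<Longrightarrow> rel G X y z \<Longrightarrow> walk S x z"
  unfolding walk_def by (rule rtranclp.rtrancl_into_rtrancl) auto

lemma walk_trans: "walk S x y \<Longrightarrow> walk S y z \<Longrightarrow> walk S x z"
  unfolding walk_def by (rule rtranclp_trans)

lemma walk_induct [consumes 1, case_names refl step]:
  assumes "walk S x y" "P x"
    and "\<And>y z X. walk S x y \<Longrightarrow> P y \<Longrightarrow> X \<in> S \<Longrightarrow> rel G X y z \<Longrightarrow> P z"
  shows "P y"
  using assms(1) unfolding walk_def
  by (induction rule: rtranclp_induct) (use assms(2,3) in \<open>auto simp: walk_def\<close>)

lemma walk_universe: "walk S x y \<Longrightarrow> x \<in> universe G \<Longrightarrow> y \<in> universe G"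
  by (induction rule: walk_induct) (auto dest: rel_universe)

text \<open>The commuting squares over the single steps are glued into a ladder, whose other side is
  the parallel walk from \<open>x'\<close>.\<close>

lemma walk_commute:
  assumes "walk S x y" "rel G Y x x'" "\<And>X. X \<in> S \<Longrightarrow> orth X Y"
  shows "\<exists>y'. rel G Y y y' \<and> walk S x' y'"
  using assms(1)
proof (induction rule: walk_induct)
  case refl
  then show ?case using assms(2) by auto
next
  case (step y z X)
  then show ?case using commute[OF assms(3)] walk_step by meson
qed

lemma walk_has:
  assumes "walk S x y" "\<And>X. X \<in> S \<Longrightarrow> orth X Y"
  shows "has G Y x \<longleftrightarrow> has G Y y"
  using assms(1) by (induction rule: walk_induct) (use has_orth assms(2) in blast)+

section \<open>Orbits of partial injections on a finite set\<close>

lemma orbit_returns: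
  assumes "w \<in> universe G" and total: "\<And>k. has G X ((app G X ^^ k) w)"
  shows "\<exists>d. rel G X ((app G X ^^ d) w) w"
proof -
  define f where "f k = (app G X ^^ k) w" for k
  have step: "rel G X (f k) (f (Suc k))" for k
    using total rel_app by (simp add: f_def)
  have "range f \<subseteq> universe G"
    using step rel_universe by auto
  then have "\<not> inj f"
    using finite_universe finite_imageD finite_subset infinite_UNIV_nat by metis
  then obtain i j where "i < j" "f i = f j"
    by (metis injI linorder_neqE_nat)
  then obtain d where "f i = f (i + Suc d)"
    by (metis less_imp_Suc_add add_Suc_right)
  \<comment> \<open>Injectivity cancels the \<open>i\<close> common steps, so the start itself
    recurs; writing the gap as \<open>Suc d\<close> makes the \<open>d\<close>-th iterate its
    predecessor.\<close>
  then have "f 0 = f (Suc d)"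
  proof (induction i)
    case (Suc i)
    then show ?case using rel_inj[OF step[of i]] step[of "i + Suc d"] by simp
  qed simp
  then show ?thesis using step[of d] by (auto simp: f_def)
qed

text \<open>A start without predecessor is never revisited, so its orbit cannot be total; the least
  failing index gives \<open>n\<close>, and all earlier steps exist.\<close>

lemma orbit_ends:
  assumes "w \<in> universe G" "\<not> has G (opp X) w"
  obtains n where "\<And>k. k < n \<Longrightarrow> rel G X ((app G X ^^ k) w) ((app G X ^^ Suc k) w)"
    and "(app G X ^^ n) w \<in> universe G" "\<not> has G X ((app G X ^^ n) w)"
proof -
  have ex: "\<exists>k. \<not> has G X ((app G X ^^ k) w)"
    using orbit_returns[OF assms(1)] assms(2) rel_opp unfolding has_iff by metis
  define n where "n = (LEAST k. \<not> has G X ((app G X ^^ k) w))"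
  have n: "\<not> has G X ((app G X ^^ n) w)"
    unfolding n_def by (rule LeastI_ex[OF ex])
  have step: "rel G X ((app G X ^^ k) w) ((app G X ^^ Suc k) w)" if "k < n" for k
    using not_less_Least[of k] that rel_app unfolding n_def by auto
  moreover have "(app G X ^^ n) w \<in> universe G"
    using step[of "n - 1"] assms(1) rel_universe by (cases n) auto
  ultimately show ?thesis using that n by blast
qed

text \<open>An element where direction \<open>X\<close> stops is the start of an orbit in the
  opposite direction, and this orbit has to end.\<close>

lemma missing_opp:
  assumes "w \<in> universe G" "\<not> has G X w"
  shows "\<exists>w\<in>universe G. \<not> has G (opp X) w"
  using orbit_ends[of w "opp X"] assms by auto

section \<open>Binary counters on cyclic lines\<close>

lemma walk_back:
  assumes total: "\<And>x. x \<in> universe G \<Longrightarrow> has G X x" and "rel G X x y"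
  shows "walk {X} y x"
proof -
  have y: "y \<in> universe G" using assms(2) rel_universe by blast
  have *: "(app G X ^^ k) y \<in> universe G \<and> walk {X} y ((app G X ^^ k) y)" for k
  proof (induction k)
    case (Suc k)
    then have "rel G X ((app G X ^^ k) y) ((app G X ^^ Suc k) y)"
      using total rel_app by simp
    then show ?case using Suc rel_universe walk_step by blast
  qed (use y in simp)
  \<comment> \<open>The orbit of \<open>y\<close> is a cycle; the element on it just before
    \<open>y\<close> is \<open>x\<close>, by injectivity.\<close>
  then show ?thesis
    using orbit_returns[OF y] total rel_inj[OF assms(2)] by metis
qed

text \<open>Without such a switch, falsity of \<open>B\<close> would propagate from \<open>x\<close>
  along the whole walk.\<close>

lemma walk_rises:
  assumes "walk {X} x y" "\<not> B x" "B y"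
  shows "\<exists>z. walk {X} x z \<and> \<not> B z \<and> B (app G X z)"
proof (rule ccontr)
  assume none: "\<not> ?thesis"
  from assms(1) have "\<not> B y"
    by (induction rule: walk_induct) (use assms(2) none app_eq in auto)
  then show False using assms(3) by simp
qed

text \<open>Common form of both counters: \<open>h\<close> points from less to more significant bits
  and \<open>v\<close> towards the previous counter value. If \<open>v\<close> were total, carries
  would reach the last position along \<open>h\<close> and set a forbidden overflow bit.\<close>

lemma counter_ends:
  assumes orth: "orth h v"
    and incr: "\<And>x. x \<in> universe G \<Longrightarrow> has G v x \<Longrightarrow> (B x \<noteq> B (app G v x)) \<longleftrightarrow>
      \<not> has G (opp h) x \<or> (\<not> B (app G (opp h) x) \<and> B (app G v (app G (opp h) x)))"
    and no_overflow: "\<And>x. x \<in> universe G \<Longrightarrow> \<not> has G h x \<Longrightarrow> \<not> B x"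
    and w: "w \<in> universe G" "\<not> has G (opp h) w"
  shows "\<exists>x\<in>universe G. \<not> has G v x"
proof (rule ccontr)
  assume "\<not> ?thesis"
  then have total: "has G v x" if "x \<in> universe G" for x using that by blast
  \<comment> \<open>A rise along \<open>v\<close> is a fall from 1 to 0 in counting order, since
    \<open>v\<close> points backwards; this is exactly the carry into the next bit.\<close>
  define rises where "rises x \<longleftrightarrow> (\<exists>y. walk {v} x y \<and> \<not> B y \<and> B (app G v y))" for x
  have rises: "rises x" if x: "x \<in> universe G" and flip: "B x \<noteq> B (app G v x)" for x
  proof (cases "B x")
    case True
    have step: "rel G v x (app G v x)" using total x rel_app by blast
    \<comment> \<open>Here the bit drops along \<open>v\<close>; going on around the cycle back to
      \<open>x\<close>, it has to rise again.\<close>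
    obtain z where "walk {v} (app G v x) z" "\<not> B z" "B (app G v z)"
      using walk_rises[OF walk_back[OF total step], of B] True flip by auto
    then show ?thesis
      unfolding rises_def using walk_trans walk_step[OF walk_refl _ step] by blast
  next
    case False
    then show ?thesis unfolding rises_def using flip walk_refl by blast
  qed
  have carry: "rises x'" if "rises x" and xx': "rel G h x x'" for x x'
  proof -
    obtain y where y: "walk {v} x y" "\<not> B y" "B (app G v y)"
      using \<open>rises x\<close> unfolding rises_def by blast
    then obtain y' where y': "rel G h y y'" "walk {v} x' y'"
      using walk_commute[OF _ xx'] orth_sym[OF orth] by blast
    have "has G (opp h) y'" "app G (opp h) y' = y" "y' \<in> universe G"
      using y'(1) rel_opp app_eq has_iff rel_universe by blast+
    \<comment> \<open>The rise at \<open>y\<close> is the carry condition for its neighbour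
      \<open>y'\<close>, so the bit at \<open>y'\<close> flips.\<close>
    then have "rises y'" using rises incr total y by metis
    then show ?thesis unfolding rises_def using y'(2) walk_trans by blast
  qed
  obtain n where n: "\<And>k. k < n \<Longrightarrow> rel G h ((app G h ^^ k) w) ((app G h ^^ Suc k) w)"
    "(app G h ^^ n) w \<in> universe G" "\<not> has G h ((app G h ^^ n) w)"
    using orbit_ends[OF w] by blast
  have "k \<le> n \<Longrightarrow> rises ((app G h ^^ k) w)" for k
  proof (induction k)
    case 0
    \<comment> \<open>At the least significant position the carry always holds, so the bit flips at
      every step.\<close>
    then show ?case using rises incr w total by simp
  next
    case (Suc k)
    then show ?case using carry[OF _ n(1)[of k]] by simp
  qed
  then obtain y where y: "walk {v} ((app G h ^^ n) w) y" "B (app G v y)"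
    unfolding rises_def by blast
  have "y \<in> universe G" using walk_universe y n by blast
  then have step: "rel G v y (app G v y)" using total rel_app by blast
  \<comment> \<open>The missing \<open>h\<close>-neighbour is shared by the whole
    \<open>v\<close>-line, so the set bit found on it contradicts
    \<open>no_overflow\<close>.\<close>
  have "\<not> has G h (app G v y)"
    using walk_has[OF walk_step[OF y(1) _ step]] orth_sym[OF orth] n(3) by blast
  then show False using no_overflow y(2) step rel_universe by blast
qed

section \<open>Every line has an end\<close>

lemma row_end:
  assumes "walk UNIV a x" "\<not> has G X a"
  shows "\<exists>c. \<not> has G X c \<and> walk {X, opp X} c x"
  using assms(1)
proof (induction rule: walk_induct)
  case refl
  then show ?case using assms(2) walk_refl by blast
next
  case (step y z Y)
  then obtain c where c: "\<not> has G X c" "walk {X, opp X} c y" by blast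
  show ?case
  proof (cases "orth X Y")
    \<comment> \<open>An orthogonal step shifts the whole line to a parallel one, where the
      translate \<open>c'\<close> of \<open>c\<close> still lacks an \<open>X\<close>-neighbour. A
      step along the line, in the other case, keeps \<open>c\<close>.\<close>
    case True
    have orth: "orth Z Y" if "Z \<in> {X, opp X}" for Z using True that by auto
    have "has G Y c"
      using walk_has[OF c(2) orth] step.hyps has_iff by blast
    then obtain c' where c': "rel G Y c c'" using has_iff by blast
    then obtain z' where "rel G Y y z'" "walk {X, opp X} c' z'"
      using walk_commute[OF c(2) c' orth] by blast
    moreover have "\<not> has G X c'" using has_orth[OF orth_sym[OF True] c'] c(1) by blast
    ultimately show ?thesis using rel_unique step.hyps by blast
  next
    case False
    then have "Y \<in> {X, opp X}" by (auto simp: orth_def)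
    then show ?thesis using c walk_step step.hyps by blast
  qed
qed

section \<open>Coordinates from a top left corner\<close>

lemma isomorphic_grid:
  assumes conn: "\<And>x y. x \<in> universe G \<Longrightarrow> y \<in> universe G \<Longrightarrow> walk UNIV x y"
    and corner: "c \<in> universe G" "\<not> has G L c" "\<not> has G U c"
  shows "\<exists>xmax ymax. 0 \<le> xmax \<and> 0 \<le> ymax \<and> isomorphic (lrud.truncate G) (grid xmax ymax)"
proof -
  obtain m where m: "\<And>k. k < m \<Longrightarrow> rel G R ((app G R ^^ k) c) ((app G R ^^ Suc k) c)"
      "\<not> has G R ((app G R ^^ m) c)"
    using orbit_ends[of c R] corner by auto
  obtain n where n: "\<And>k. k < n \<Longrightarrow> rel G D ((app G D ^^ k) c) ((app G D ^^ Suc k) c)"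
      "\<not> has G D ((app G D ^^ n) c)"
    using orbit_ends[of c D] corner by auto
  have orth_RD: "orth R D" "orth D R" "orth R U" "orth D L" by (auto simp: orth_def)
  define g where "g i j = (app G D ^^ j) ((app G R ^^ i) c)" for i j
  \<comment> \<open>The double induction completes each square from its upper and left sides by
    commutativity. The guards \<open>0 < j\<close> and \<open>0 < i\<close> exclude truncated
    subtraction.\<close>
  have square: "i \<le> m \<Longrightarrow> j \<le> n \<Longrightarrow>
      (0 < j \<longrightarrow> rel G D (g i (j - 1)) (g i j)) \<and> (0 < i \<longrightarrow> rel G R (g (i - 1) j) (g i j))" for i j
  proof (induction i arbitrary: j)
    case 0
    then show ?case using n(1)[of "j - 1"] by (cases j) (auto simp: g_def)
  next
    case (Suc i)
    note IH = Suc.IH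
    from Suc.prems(2) show ?case
    proof (induction j)
      case 0
      then show ?case using m(1)[of i] Suc.prems(1) by (auto simp: g_def)
    next
      case (Suc j)
      have "rel G R (g i j) (g (Suc i) j)" using Suc by simp
      moreover have "rel G D (g i j) (g i (Suc j))"
        using Suc.prems \<open>Suc i \<le> m\<close> IH[of "Suc j"] by simp
      ultimately obtain t where t: "rel G R (g i (Suc j)) t" "rel G D (g (Suc i) j) t"
        using commute[OF orth_RD(1)] by blast
      moreover have "t = g (Suc i) (Suc j)" using app_eq[OF t(2)] by (simp add: g_def)
      ultimately show ?case by simp
    qed
  qed
  have stepD: "rel G D (g i j) (g i (Suc j))" if "i \<le> m" "j < n" for i j
    using square[of i "Suc j"] that by simp
  have stepR: "rel G R (g i j) (g (Suc i) j)" if "i < m" "j \<le> n" for i j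
    using square[of "Suc i" j] that by simp
  \<comment> \<open>The four borders inherit their missing neighbours from \<open>c\<close> and from
    the ends of the two orbits through \<open>c\<close>.\<close>
  have top: "\<not> has G U (g i 0)" if "i \<le> m" for i
    using that
  proof (induction i)
    case (Suc i)
    then show ?case using has_orth[OF orth_RD(3) stepR[of i 0]] by simp
  qed (use corner in \<open>simp add: g_def\<close>)
  have bottom: "\<not> has G D (g i n)" if "i \<le> m" for i
    using that
  proof (induction i)
    case (Suc i)
    then show ?case using has_orth[OF orth_RD(1) stepR[of i n]] by simp
  qed (use n(2) in \<open>simp add: g_def\<close>)
  have left: "\<not> has G L (g 0 j)" if "j \<le> n" for j
    using that
  proof (induction j)
    case (Suc j)
    then show ?case using has_orth[OF orth_RD(4) stepD[of 0 j]] by simp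
  qed (use corner in \<open>simp add: g_def\<close>)
  have right: "\<not> has G R (g m j)" if "j \<le> n" for j
    using that
  proof (induction j)
    case (Suc j)
    then show ?case using has_orth[OF orth_RD(2) stepD[of m j]] by simp
  qed (use m(2) in \<open>simp add: g_def\<close>)
  have relL: "rel G L y x \<longleftrightarrow> rel G R x y" and relU: "rel G U y x \<longleftrightarrow> rel G D x y" for x y
    using rel_opp[of R] rel_opp[of D] by simp_all
  have noR: "\<not> rel G R x (g 0 j)" if "j \<le> n" for x j
    using left[OF that] relL has_iff by blast
  have noD: "\<not> rel G D x (g i 0)" if "i \<le> m" for x i
    using top[OF that] relU has_iff by blast
  \<comment> \<open>Equal elements have equal left neighbours, so both column indices decrease
    together; column 0 has nothing to its left, so they reach 0 at the same time.\<close>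
  have inj_i: "i = i'" if "g i j = g i' j'" "i \<le> m" "i' \<le> m" "j \<le> n" "j' \<le> n" for i i' j j'
    using that
  proof (induction i arbitrary: i')
    case 0
    then show ?case using noR[of j] stepR[of "i' - 1" j'] by (cases i') auto
  next
    case (Suc i)
    then obtain k where k: "i' = Suc k"
      using noR[of j'] stepR[of i j] by (cases i') auto
    then have "g i j = g k j'"
      using Suc.prems rel_inj[OF stepR[of i j], of "g k j'"] stepR[of k j'] by simp
    then show ?case using Suc k by simp
  qed
  have inj_j: "j = j'" if "g i j = g i' j'" "i \<le> m" "i' \<le> m" "j \<le> n" "j' \<le> n" for i i' j j'
    using that
  proof (induction j arbitrary: j')
    case 0
    then show ?case using noD[of i] stepD[of i' "j' - 1"] by (cases j') auto
  next
    case (Suc j)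
    then obtain k where k: "j' = Suc k"
      using noD[of i'] stepD[of i j] by (cases j') auto
    then have "g i j = g i' k"
      using Suc.prems rel_inj[OF stepD[of i j], of "g i' k"] stepD[of i' k] by simp
    then show ?case using Suc k by simp
  qed
  have R_iff: "rel G R (g i j) y \<longleftrightarrow> i < m \<and> y = g (Suc i) j" if "i \<le> m" "j \<le> n" for i j y
    using stepR[of i j] right[of j] that rel_unique has_iff by (metis le_neq_implies_less)
  have D_iff: "rel G D (g i j) y \<longleftrightarrow> j < n \<and> y = g i (Suc j)" if "i \<le> m" "j \<le> n" for i j y
    using stepD[of i j] bottom[of i] that rel_unique has_iff by (metis le_neq_implies_less)
  have L_cases: "i > 0 \<and> y = g (i - 1) j" if "rel G L (g i j) y" "i \<le> m" "j \<le> n" for i j y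
    using that noR[of j y] stepR[of "i - 1" j] rel_inj[of R y "g i j"] by (cases i) (auto simp: relL)
  have U_cases: "j > 0 \<and> y = g i (j - 1)" if "rel G U (g i j) y" "i \<le> m" "j \<le> n" for i j y
    using that noD[of i y] stepD[of i "j - 1"] rel_inj[of D y "g i j"] by (cases j) (auto simp: relU)
  \<comment> \<open>The image of \<open>g\<close> contains \<open>c\<close> and is closed under
    steps in all four directions, so connectedness makes it the whole universe.\<close>
  have surj: "\<exists>i j. i \<le> m \<and> j \<le> n \<and> x = g i j" if "x \<in> universe G" for x
    using conn[OF corner(1) that]
  proof (induction rule: walk_induct)
    case refl
    have "c = g 0 0" by (simp add: g_def)
    then show ?case by blast
  next
    case (step y z X)
    then obtain i j where ij: "i \<le> m" "j \<le> n" "y = g i j" by blast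
    show ?case
    proof (cases X)
      case L
      then show ?thesis using L_cases[of i j z] ij step by (meson diff_le_self le_trans)
    next
      case R
      then show ?thesis using R_iff ij step by (metis Suc_leI)
    next
      case U
      then show ?thesis using U_cases[of i j z] ij step by (meson diff_le_self le_trans)
    next
      case D
      then show ?thesis using D_iff ij step by (metis Suc_leI)
    qed
  qed
  have g_univ: "g i j \<in> universe G" if "i \<le> m" "j \<le> n" for i j
    using square[OF that] rel_universe corner(1) by (cases i; cases j) (auto simp: g_def)
  define A where "A = {0..int m} \<times> {0..int n}"
  define h where "h p = g (nat (fst p)) (nat (snd p))" for p :: "int \<times> int"
  have bij: "bij_betw h A (universe G)"
    unfolding bij_betw_def
  proof
    show "inj_on h A"
    proof (rule inj_onI)
      fix p q assume "p \<in> A" "q \<in> A" "h p = h q"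
      then show "p = q"
        using inj_i[of "nat (fst p)" "nat (snd p)" "nat (fst q)" "nat (snd q)"]
          inj_j[of "nat (fst p)" "nat (snd p)" "nat (fst q)" "nat (snd q)"]
        by (auto simp: A_def h_def nat_le_iff eq_nat_nat_iff)
    qed
    show "h ` A = universe G"
    proof
      show "h ` A \<subseteq> universe G" using g_univ by (auto simp: A_def h_def)
      show "universe G \<subseteq> h ` A"
      proof
        fix x assume "x \<in> universe G"
        then obtain i j where "i \<le> m" "j \<le> n" "x = g i j" using surj by blast
        then have "(int i, int j) \<in> A" "x = h (int i, int j)" by (auto simp: A_def h_def)
        then show "x \<in> h ` A" by blast
      qed
    qed
  qed
  have coords: "\<exists>i j. p = (int i, int j) \<and> i \<le> m \<and> j \<le> n" if "p \<in> A" for p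
    using that by (cases p) (auto simp: A_def dest!: zero_le_imp_eq_int)
  have hR: "rel G R (h p) (h q) \<longleftrightarrow> q = step R p" if pq: "p \<in> A" "q \<in> A" for p q
  proof -
    obtain x y x' y' where xy: "p = (int x, int y)" "q = (int x', int y')"
        "x \<le> m" "y \<le> n" "x' \<le> m" "y' \<le> n"
      using coords pq by metis
    have "rel G R (h p) (h q) \<longleftrightarrow> x < m \<and> g x' y' = g (Suc x) y"
      using R_iff xy by (simp add: h_def)
    also have "\<dots> \<longleftrightarrow> x' = Suc x \<and> y' = y"
      using xy inj_i[of x' y' "Suc x" y] inj_j[of x' y' "Suc x" y] by auto
    finally show ?thesis using xy by auto
  qed
  have hD: "rel G D (h p) (h q) \<longleftrightarrow> q = step D p" if pq: "p \<in> A" "q \<in> A" for p q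
  proof -
    obtain x y x' y' where xy: "p = (int x, int y)" "q = (int x', int y')"
        "x \<le> m" "y \<le> n" "x' \<le> m" "y' \<le> n"
      using coords pq by metis
    have "rel G D (h p) (h q) \<longleftrightarrow> y < n \<and> g x' y' = g x (Suc y)"
      using D_iff xy by (simp add: h_def)
    also have "\<dots> \<longleftrightarrow> x' = x \<and> y' = Suc y"
      using xy inj_i[of x' y' x "Suc y"] inj_j[of x' y' x "Suc y"] by auto
    finally show ?thesis using xy by auto
  qed
  \<comment> \<open>\<open>L\<close> and \<open>U\<close> are the converses of \<open>R\<close> and
    \<open>D\<close>, so their cases follow with \<open>p\<close> and \<open>q\<close>
    exchanged.\<close>
  have h_rel: "rel G X (h p) (h q) \<longleftrightarrow> q = step X p" if "p \<in> A" "q \<in> A" for X p q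
    by (cases X; cases p; cases q) (use hR hD that in \<open>auto simp: relL relU\<close>)
  \<comment> \<open>\<open>isomorphic\<close> asks for a map from the structure to the grid, whereas
    \<open>h\<close> runs the other way.\<close>
  define f where "f = inv_into A h"
  have f: "bij_betw f (universe G) A"
    unfolding f_def by (rule bij_betw_inv_into[OF bij])
  have "rel G X x y \<longleftrightarrow> f x \<in> A \<and> f y \<in> A \<and> f y = step X (f x)"
    if "x \<in> universe G" "y \<in> universe G" for X x y
  proof -
    have "f x \<in> A" "f y \<in> A" using f that bij_betwE by blast+
    moreover have "h (f x) = x" "h (f y) = y"
      using that bij bij_betw_inv_into_right unfolding f_def by fastforce+
    ultimately show ?thesis using h_rel[of "f x" "f y" X] by simp
  qed
  then have "isomorphic (lrud.truncate G) (grid (int m) (int n))"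
    unfolding isomorphic_def grid_def lrud.truncate_def A_def[symmetric] using f by auto
  then show ?thesis using of_nat_0_le_iff by blast
qed

end

section \<open>From the axioms to a corner\<close>

theorem theorem1:
  fixes G :: "'a counter_structure"
  assumes "is_structure G"
    and "finite (universe G)"
    and "phi1 G"
    and "gaifman_connected G"
    and "\<exists>v \<in> universe G. \<exists>X. \<not> (\<exists>w \<in> universe G. rel G X v w)"
  shows "\<exists>xmax ymax. 0 \<le> xmax \<and> 0 \<le> ymax \<and> isomorphic (lrud.truncate G) (grid xmax ymax)"
proof -
  have univ: "x \<in> universe G \<and> y \<in> universe G" if "rel G X x y" for X x y
    using assms(1) that unfolding is_structure_def by blast
  have pf: "partial_functionality G" and inv: "inverses G" and comm: "commutativity G"
    and hc: "horizontal_counter G" and vc: "vertical_counter G"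
    using assms(3) by (auto simp: phi1_def)
  have opp: "rel G (opp X) y x \<longleftrightarrow> rel G X x y" for X x y
    using inv univ unfolding inverses_def by (cases X) (simp; blast)+
  interpret commuting_structure G
  proof
    show "finite (universe G)" by fact
    show "x \<in> universe G \<and> y \<in> universe G" if "rel G X x y" for X x y using univ that .
    show "y = z" if "rel G X x y" "rel G X x z" for X x y z
      using pf univ that unfolding partial_functionality_def by blast
    show "rel G (opp X) y x \<longleftrightarrow> rel G X x y" for X x y by (rule opp)
    show "\<exists>t. rel G X z t \<and> rel G Y y t" if "orth X Y" "rel G X x y" "rel G Y x z" for X Y x y z
    proof -
      \<comment> \<open>The axiom lists the horizontal direction first, but its conclusion is
        symmetric, so both orders are covered.\<close>
      have "X \<in> {L, R} \<and> Y \<in> {U, D} \<or> Y \<in> {L, R} \<and> X \<in> {U, D}"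
        using \<open>orth X Y\<close> by (cases X; cases Y; simp add: orth_def)
      then show ?thesis
        using comm univ that(2,3) unfolding commutativity_def by meson
    qed
  qed
  have conn: "walk UNIV x y" if "x \<in> universe G" "y \<in> universe G" for x y
  proof -
    \<comment> \<open>An edge traversed backwards is a step in the opposite direction.\<close>
    have "gaifman_adj G \<le> (\<lambda>x y. \<exists>X\<in>UNIV. rel G X x y)"
      using opp unfolding gaifman_adj_def by blast
    then show ?thesis
      using assms(4) that rtranclp_mono unfolding gaifman_connected_def walk_def by blast
  qed
  define missing where "missing X \<longleftrightarrow> (\<exists>x\<in>universe G. \<not> has G X x)" for X
  have missing_opp: "missing (opp X)" if "missing X" for X
    using that missing_opp unfolding missing_def by blast
  \<comment> \<open>\<open>BV\<close> has its least significant bit on the left and its previous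
    value above: \<open>h\<close> is \<open>R\<close> and \<open>v\<close> is
    \<open>U\<close>.\<close>
  have V: "missing U" if "missing L"
    using that counter_ends[of R U "BV G"] hc
    unfolding missing_def horizontal_counter_def carryV_def by (auto simp: orth_def)
  \<comment> \<open>\<open>BH\<close> has its least significant bit at the bottom and its previous
    value to the right: \<open>h\<close> is \<open>U\<close> and \<open>v\<close> is
    \<open>R\<close>.\<close>
  have H: "missing R" if "missing D"
    using that counter_ends[of U R "BH G"] vc
    unfolding missing_def vertical_counter_def carryH_def by (auto simp: orth_def)
  obtain X where "missing X"
    using assms(5) unfolding missing_def has_def by blast
  \<comment> \<open>Reversal links \<open>L\<close> with \<open>R\<close> and \<open>U\<close> with
    \<open>D\<close>; \<open>V\<close> and \<open>H\<close> link the two axes both ways.\<close>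
  then have "missing L \<and> missing U"
    using V H missing_opp[of L] missing_opp[of R] missing_opp[of U] missing_opp[of D]
    by (cases X) auto
  then obtain a b where a: "a \<in> universe G" "\<not> has G L a" and b: "b \<in> universe G" "\<not> has G U b"
    unfolding missing_def by blast
  \<comment> \<open>\<open>c\<close> is the left end of the row of \<open>b\<close>; since
    \<open>b\<close> has no upper neighbour, neither has any element of that row, so
    \<open>c\<close> is a corner.\<close>
  obtain c where c: "\<not> has G L c" "walk {L, opp L} c b"
    using row_end[OF conn[OF a(1) b(1)] a(2)] by blast
  have "\<not> has G U c"
    using walk_has[OF c(2), of U] b(2) by (force simp: orth_def)
  moreover have "c \<in> universe G"
    using c(2) b(1) univ unfolding walk_def by (blast elim: converse_rtranclpE)
  ultimately show ?thesis using isomorphic_grid conn c(1) by blast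
qed

end
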